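(* Let $P$ be a finite rooted tree poset. Then the winner of the Ungar game on $P$ is given by the output of the boolean $\mathrm{NAND}$ formula on $P$ on inputs of all $0$: $P$ is an Eeta win if this output is $1$, and $P$ is an Atniss win if this output is $0$.
   Context: Ungar game: for a finite poset $P$, the positions are order ideals (down-closed subsets) $X$ of $P$, the starting position being $X=P$. A nontrivial Ungar move replaces $X$ by $X\setminus T$, where $T$ is a nonempty subset of the set $\max(X)$ of maximal elements of $X$. Two players, Atniss (who moves first) and Eeta (who moves second), alternate making nontrivial Ungar moves; the first player who cannot make one (i.e. the player to move when $X=\varnothing$) loses. A finite poset $P$ is an Atniss win if the first player has a winning strategy starting from $P$, and an Eeta win otherwise. A rooted tree poset is a poset with a single maximal element whose Hasse diagram is, as a graph, a tree. $\mathrm{NAND}:\{0,1\}^*\to\{0,1\}$ returns $0$ if and only if every letter of the input string is $1$. The boolean NAND formula on a finite rooted tree poset $P$ is the Hasse diagram of $P$ with each edge directed from the covered element to the covering element. On inputs of all $0$, every source node (minimal element of $P$) is assigned the value $0$, and every non-minimal element is assigned the NAND of the values of the elements it covers. The output is the value of the sink node (the maximal element of $P$). (If $P$ has one element, the output is its assigned value $0$.) *)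

theory Defs
  imports Main
begin

text \<open>
  A poset is a carrier set \<open>P\<close> with a relation \<open>r\<close> such that \<open>partial_order_on P r\<close>;
  \<open>(x, y) \<in> r\<close> reads \<open>x \<le> y\<close>. In particular \<open>r \<subseteq> P \<times> P\<close>, which is why some notions
  below mention \<open>r\<close> only.
\<close>

definition max_elems :: "'a rel \<Rightarrow> 'a set \<Rightarrow> 'a set" where
  "max_elems r X = {x \<in> X. \<forall>y\<in>X. (x, y) \<in> r \<longrightarrow> y = x}"

definition min_elems :: "'a rel \<Rightarrow> 'a set \<Rightarrow> 'a set" where
  "min_elems r X = {x \<in> X. \<forall>y\<in>X. (y, x) \<in> r \<longrightarrow> y = x}"

definition order_ideal :: "'a set \<Rightarrow> 'a rel \<Rightarrow> 'a set \<Rightarrow> bool" where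
  "order_ideal P r X \<longleftrightarrow> X \<subseteq> P \<and> (\<forall>x\<in>X. \<forall>y. (y, x) \<in> r \<longrightarrow> y \<in> X)"

definition covered_by :: "'a rel \<Rightarrow> 'a \<Rightarrow> 'a \<Rightarrow> bool" where
  "covered_by r x y \<longleftrightarrow>
     (x, y) \<in> r \<and> x \<noteq> y \<and> (\<forall>z. (x, z) \<in> r \<and> (z, y) \<in> r \<longrightarrow> z = x \<or> z = y)"


section \<open>Rooted tree posets\<close>

text \<open>
  The Hasse diagram as an undirected simple graph. The predicate \<open>tree\<close> of the AFP entry
  \<open>Graph_Theory\<close> is not usable here: its \<open>forest\<close> excludes directed cycles only, so it holds
  for every Hasse diagram oriented along the order.
\<close>

definition hasse_adj :: "'a rel \<Rightarrow> 'a \<Rightarrow> 'a \<Rightarrow> bool" where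
  "hasse_adj r x y \<longleftrightarrow> covered_by r x y \<or> covered_by r y x"

definition graph_connected :: "'a set \<Rightarrow> ('a \<Rightarrow> 'a \<Rightarrow> bool) \<Rightarrow> bool" where
  "graph_connected V adj \<longleftrightarrow> V \<noteq> {} \<and>
     (\<forall>u\<in>V. \<forall>v\<in>V. \<exists>w. w \<noteq> [] \<and> set w \<subseteq> V \<and> hd w = u \<and> last w = v \<and> successively adj w)"

text \<open>A cycle is listed without repeating its first vertex.\<close>

definition graph_cycle :: "'a set \<Rightarrow> ('a \<Rightarrow> 'a \<Rightarrow> bool) \<Rightarrow> 'a list \<Rightarrow> bool" where
  "graph_cycle V adj c \<longleftrightarrow>
     3 \<le> length c \<and> distinct c \<and> set c \<subseteq> V \<and> successively adj c \<and> adj (last c) (hd c)"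

definition graph_tree :: "'a set \<Rightarrow> ('a \<Rightarrow> 'a \<Rightarrow> bool) \<Rightarrow> bool" where
  "graph_tree V adj \<longleftrightarrow> graph_connected V adj \<and> (\<nexists>c. graph_cycle V adj c)"

definition rooted_tree_poset :: "'a set \<Rightarrow> 'a rel \<Rightarrow> bool" where
  "rooted_tree_poset P r \<longleftrightarrow>
     partial_order_on P r \<and> (\<exists>!x. x \<in> max_elems r P) \<and> graph_tree P (hasse_adj r)"


section \<open>The Ungar game\<close>

definition ungar_move :: "'a rel \<Rightarrow> 'a set \<Rightarrow> 'a set \<Rightarrow> bool" where
  "ungar_move r X Y \<longleftrightarrow> (\<exists>T. T \<noteq> {} \<and> T \<subseteq> max_elems r X \<and> Y = X - T)"

text \<open>
  The nonempty list of positions reached so far, starting with \<open>P\<close>. Atniss is to move after a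
  play of odd length, Eeta after a play of even length.
\<close>

definition ungar_play :: "'a set \<Rightarrow> 'a rel \<Rightarrow> 'a set list \<Rightarrow> bool" where
  "ungar_play P r h \<longleftrightarrow> h \<noteq> [] \<and> hd h = P \<and> successively (ungar_move r) h"

definition finished_play :: "'a set \<Rightarrow> 'a rel \<Rightarrow> 'a set list \<Rightarrow> bool" where
  "finished_play P r h \<longleftrightarrow> ungar_play P r h \<and> (\<nexists>Y. ungar_move r (last h) Y)"

text \<open>
  A strategy of the first player maps the play so far to the next position; it has to choose a
  legal move whenever it is Atniss's turn and there is one.
\<close>

definition first_player_strategy :: "'a set \<Rightarrow> 'a rel \<Rightarrow> ('a set list \<Rightarrow> 'a set) \<Rightarrow> bool" where
  "first_player_strategy P r \<sigma> \<longleftrightarrow>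
     (\<forall>h. ungar_play P r h \<and> odd (length h) \<and> (\<exists>Y. ungar_move r (last h) Y)
        \<longrightarrow> ungar_move r (last h) (\<sigma> h))"

definition follows_strategy :: "('a set list \<Rightarrow> 'a set) \<Rightarrow> 'a set list \<Rightarrow> bool" where
  "follows_strategy \<sigma> h \<longleftrightarrow>
     (\<forall>i. even i \<and> Suc i < length h \<longrightarrow> h ! Suc i = \<sigma> (take (Suc i) h))"

text \<open>
  In a finished play of even length Eeta is to move and cannot, so Atniss has won. (Plays on a
  finite poset cannot go on forever.)
\<close>

definition atniss_win :: "'a set \<Rightarrow> 'a rel \<Rightarrow> bool" where
  "atniss_win P r \<longleftrightarrow>
     (\<exists>\<sigma>. first_player_strategy P r \<sigma> \<and>
        (\<forall>h. finished_play P r h \<and> follows_strategy \<sigma> h \<longrightarrow> even (length h)))"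

definition eeta_win :: "'a set \<Rightarrow> 'a rel \<Rightarrow> bool" where
  "eeta_win P r \<longleftrightarrow> \<not> atniss_win P r"

text \<open>Positions are automatically order ideals.\<close>

lemma order_ideal_ungar_move:
  assumes "order_ideal P r X" and "ungar_move r X Y"
  shows "order_ideal P r Y"
  using assms unfolding order_ideal_def ungar_move_def max_elems_def by auto

lemma order_ideal_successively:
  assumes "successively (ungar_move r) h" and "h \<noteq> []" and "order_ideal P r (hd h)"
    and "X \<in> set h"
  shows "order_ideal P r X"
  using assms
proof (induction h)
  case Nil
  then show ?case by simp
next
  case (Cons Y h)
  show ?case
  proof (cases "X = Y \<or> h = []")
    case True
    then show ?thesis using Cons.prems by auto
  next
    case False
    then have "ungar_move r Y (hd h)" and succ: "successively (ungar_move r) h"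
      and "X \<in> set h"
      using Cons.prems(1,4) by (simp_all add: successively_Cons)
    moreover have "order_ideal P r Y"
      using Cons.prems(3) by simp
    ultimately have "order_ideal P r (hd h)"
      using order_ideal_ungar_move by metis
    then show ?thesis
      using Cons.IH succ False \<open>X \<in> set h\<close> by simp
  qed
qed

lemma order_ideal_ungar_play:
  assumes "partial_order_on P r" and "ungar_play P r h" and "X \<in> set h"
  shows "order_ideal P r X"
proof (rule order_ideal_successively)
  show "successively (ungar_move r) h" and "h \<noteq> []"
    using assms(2) unfolding ungar_play_def by simp_all
  have "order_ideal P r P"
    using partial_order_onD(4)[OF assms(1)] unfolding order_ideal_def by blast
  then show "order_ideal P r (hd h)"
    using assms(2) unfolding ungar_play_def by simp
qed (rule assms(3))


section \<open>The boolean NAND formula\<close>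

text \<open>
  Truth values are the letters: \<open>True\<close> is \<open>1\<close> and \<open>False\<close> is \<open>0\<close>. As NAND does not depend on
  the order of the letters, its argument is a family \<open>(f i)\<close> indexed by \<open>i \<in> I\<close> instead of a
  string.
\<close>

definition nand :: "'i set \<Rightarrow> ('i \<Rightarrow> bool) \<Rightarrow> bool" where
  "nand I f \<longleftrightarrow> \<not> (\<forall>i\<in>I. f i)"

text \<open>
  Evaluation on inputs of all \<open>0\<close>, by recursion along the covering relation; see the
  equations below.
\<close>

definition nand_value :: "'a set \<Rightarrow> 'a rel \<Rightarrow> 'a \<Rightarrow> bool" where
  "nand_value P r =
     wfrec {(y, x). covered_by r y x}
       (\<lambda>val x. if x \<in> min_elems r P then False else nand {y. covered_by r y x} val)"

definition nand_output :: "'a set \<Rightarrow> 'a rel \<Rightarrow> bool" where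
  "nand_output P r = nand_value P r (THE x. x \<in> max_elems r P)"

lemma wf_covered_by:
  assumes "finite P" and "partial_order_on P r"
  shows "wf {(y, x). covered_by r y x}"
proof -
  have "finite r"
    using partial_order_onD(4)[OF assms(2)] assms(1) by (meson finite_SigmaI finite_subset)
  then have "wf (r - Id)"
    using assms(2) by (rule partial_order_on_well_order_on)
  then show ?thesis
    by (rule wf_subset) (auto simp: covered_by_def)
qed

lemma nand_value_unfold:
  assumes "finite P" and "partial_order_on P r"
  shows "nand_value P r x =
    (if x \<in> min_elems r P then False else nand {y. covered_by r y x} (nand_value P r))"
  unfolding nand_value_def
  by (subst wfrec[OF wf_covered_by[OF assms]]) (simp add: nand_def cut_apply)

lemma nand_value_minimal:
  assumes "finite P" and "partial_order_on P r" and "x \<in> min_elems r P"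
  shows "nand_value P r x = False"
  using assms(3) nand_value_unfold[OF assms(1,2), of x] by simp

lemma nand_value_nonminimal:
  assumes "finite P" and "partial_order_on P r" and "x \<notin> min_elems r P"
  shows "nand_value P r x = nand {y. covered_by r y x} (nand_value P r)"
  using assms(3) nand_value_unfold[OF assms(1,2), of x] by simp

end

theory Submission
  imports Defs
begin

text \<open>
  A position \<open>X\<close> of the Ungar game on a rooted tree is a forest whose roots are the maximal
  elements of \<open>X\<close>: deleting a root turns its children into roots, and a move deletes any nonempty
  set of roots. So the game is played on all trees of the forest at once, moving in as many of them
  as one likes, and the player to move loses precisely if each tree separately is lost for the
  player who starts on it: if all trees are lost, every move spoils one of them, and otherwise one
  moves in exactly the trees that are not lost. The only first move on a tree with root \<open>x\<close> leaves
  the forest below \<open>x\<close>, so \<open>x\<close> is lost for the player who starts iff not all its children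
  are, which is the NAND recursion; a leaf obeys the same rule, its children being
  the empty family.

  Accordingly the positions lost for the player to move are those whose maximal elements all have
  NAND value \<open>1\<close>. The lemmas \<open>move_from_lost_position\<close> and \<open>move_to_lost_position\<close> show that this
  set is a kernel of the game. That the children of a deleted root become roots themselves
  needs every element to have only one cover; this is where the tree hypothesis enters
  (\<open>unique_cover_in_rooted_tree\<close>). Finally \<open>atniss_win_iff_not_in_kernel\<close> turns a kernel into
  winning strategies.
\<close>

section \<open>From a kernel to winning strategies\<close>

lemma ungar_play_snoc:
  assumes "h \<noteq> []"
  shows "ungar_play P r (h @ [Y]) \<longleftrightarrow> ungar_play P r h \<and> ungar_move r (last h) Y"
  using assms unfolding ungar_play_def by (auto simp: successively_append_iff)

lemma follows_strategy_snoc: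
  "follows_strategy \<sigma> (h @ [Y]) \<longleftrightarrow>
     follows_strategy \<sigma> h \<and> (odd (length h) \<longrightarrow> Y = \<sigma> h)"
proof
  assume f: "follows_strategy \<sigma> (h @ [Y])"
  have "h ! Suc i = \<sigma> (take (Suc i) h)" if "even i" "Suc i < length h" for i
    using f[unfolded follows_strategy_def, rule_format, of i] that by (simp add: nth_append)
  moreover have "Y = \<sigma> h" if "odd (length h)"
    using f[unfolded follows_strategy_def, rule_format, of "length h - 1"] that
    by (cases "length h") (auto simp: nth_append)
  ultimately show "follows_strategy \<sigma> h \<and> (odd (length h) \<longrightarrow> Y = \<sigma> h)"
    unfolding follows_strategy_def by blast
next
  assume f: "follows_strategy \<sigma> h \<and> (odd (length h) \<longrightarrow> Y = \<sigma> h)"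
  have "(h @ [Y]) ! Suc i = \<sigma> (take (Suc i) (h @ [Y]))"
    if i: "even i" "Suc i < length (h @ [Y])" for i
  proof (cases "Suc i = length h")
    case True
    then have "odd (length h)"
      using i(1) by (metis even_Suc)
    then show ?thesis
      using f True by (simp add: nth_append)
  next
    case False
    then show ?thesis
      using f i unfolding follows_strategy_def by (simp add: nth_append)
  qed
  then show "follows_strategy \<sigma> (h @ [Y])"
    unfolding follows_strategy_def by blast
qed

lemma card_ungar_move_less:
  assumes "finite X" and "ungar_move r X Y"
  shows "card Y < card X"
proof -
  have "Y \<subset> X"
    using assms(2) unfolding ungar_move_def max_elems_def by blast
  then show ?thesis
    using assms(1) by (simp add: psubset_card_mono)
qed

text \<open>
  The set of positions satisfying \<open>L\<close> is a kernel of the move graph, so the player to move loses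
  exactly there: Atniss can always move into \<open>L\<close> from outside, and from a position in \<open>L\<close> Eeta can
  return to \<open>L\<close> after any move.
\<close>

lemma atniss_win_iff_not_in_kernel:
  assumes fin: "finite P" and po: "partial_order_on P r"
    and leave: "\<And>X Y. order_ideal P r X \<Longrightarrow> L X \<Longrightarrow> ungar_move r X Y \<Longrightarrow> \<not> L Y"
    and enter: "\<And>X. order_ideal P r X \<Longrightarrow> \<not> L X \<Longrightarrow> \<exists>Y. ungar_move r X Y \<and> L Y"
  shows "atniss_win P r \<longleftrightarrow> \<not> L P"
proof
  have ideal: "order_ideal P r (last h)" if "ungar_play P r h" for h
    using order_ideal_ungar_play[OF po that] that unfolding ungar_play_def by simp
  show "\<not> L P" if "atniss_win P r"
  proof
    assume "L P"
    from that obtain \<sigma> where strat: "first_player_strategy P r \<sigma>"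
      and wins: "\<And>h. finished_play P r h \<Longrightarrow> follows_strategy \<sigma> h \<Longrightarrow> even (length h)"
      unfolding atniss_win_def by blast
    \<comment> \<open>Against any strategy, Eeta keeps answering within \<open>L\<close> until Atniss is stuck.\<close>
    have "\<exists>h'. finished_play P r h' \<and> follows_strategy \<sigma> h' \<and> odd (length h')"
      if "ungar_play P r h" "follows_strategy \<sigma> h" "odd (length h)" "L (last h)" for h
      using that
    proof (induction "card (last h)" arbitrary: h rule: less_induct)
      case less
      show ?case
      proof (cases "\<exists>Y. ungar_move r (last h) Y")
        case False
        then show ?thesis
          using less.prems unfolding finished_play_def by blast
      next
        case True
        have ne: "h \<noteq> []"
          using less.prems(1) unfolding ungar_play_def by simp
        have move: "ungar_move r (last h) (\<sigma> h)"
          using strat less.prems True unfolding first_player_strategy_def by blast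
        have ideal': "order_ideal P r (\<sigma> h)"
          using order_ideal_ungar_move[OF ideal[OF less.prems(1)] move] .
        obtain Z where Z: "ungar_move r (\<sigma> h) Z" "L Z"
          using enter[OF ideal' leave[OF ideal[OF less.prems(1)] less.prems(4) move]] by blast
        have "finite (last h)" "finite (\<sigma> h)"
          using ideal[OF less.prems(1)] ideal' fin finite_subset
          unfolding order_ideal_def by blast+
        then have "card Z < card (last h)"
          using card_ungar_move_less[OF _ move] card_ungar_move_less[OF _ Z(1)] by simp
        moreover have "ungar_play P r ((h @ [\<sigma> h]) @ [Z])"
          using less.prems(1) ne move Z(1) by (simp add: ungar_play_snoc del: append_assoc)
        moreover have "follows_strategy \<sigma> ((h @ [\<sigma> h]) @ [Z])"
          using less.prems(2,3) by (simp add: follows_strategy_snoc del: append_assoc)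
        ultimately show ?thesis
          using less.hyps[of "(h @ [\<sigma> h]) @ [Z]"] less.prems(3) Z(2) by simp
      qed
    qed
    from this[of "[P]"] \<open>L P\<close> wins show False
      by (auto simp: ungar_play_def follows_strategy_def)
  qed
  show "atniss_win P r" if "\<not> L P"
  proof -
    define \<sigma> where "\<sigma> h = (if L (last h) then SOME Y. ungar_move r (last h) Y
      else SOME Y. ungar_move r (last h) Y \<and> L Y)" for h
    have \<sigma>_enter: "ungar_move r (last h) (\<sigma> h) \<and> L (\<sigma> h)"
      if "ungar_play P r h" "\<not> L (last h)" for h
      using someI_ex[OF enter[OF ideal[OF that(1)] that(2)]] that(2) unfolding \<sigma>_def by simp
    have "ungar_move r (last h) (\<sigma> h)"
      if "ungar_play P r h" "ungar_move r (last h) Y" for h Y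
    proof (cases "L (last h)")
      case True
      then show ?thesis
        using someI[of "ungar_move r (last h)", OF that(2)] unfolding \<sigma>_def by simp
    qed (use \<sigma>_enter that in blast)
    then have strat: "first_player_strategy P r \<sigma>"
      unfolding first_player_strategy_def by blast
    have inv: "ungar_play P r h \<Longrightarrow> follows_strategy \<sigma> h \<Longrightarrow> L (last h) \<longleftrightarrow> even (length h)" for h
    proof (induction h rule: rev_induct)
      case Nil
      then show ?case by (simp add: ungar_play_def)
    next
      case (snoc Y h)
      show ?case
      proof (cases "h = []")
        case True
        then show ?thesis
          using snoc.prems(1) \<open>\<not> L P\<close> by (simp add: ungar_play_def)
      next
        case False
        have play: "ungar_play P r h" and move: "ungar_move r (last h) Y"
          using snoc.prems(1) by (simp_all add: ungar_play_snoc[OF False])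
        have fol: "follows_strategy \<sigma> h" and Y: "odd (length h) \<Longrightarrow> Y = \<sigma> h"
          using snoc.prems(2) by (simp_all add: follows_strategy_snoc)
        show ?thesis
          using snoc.IH[OF play fol] Y \<sigma>_enter[OF play] leave[OF ideal[OF play] _ move]
          by auto
      qed
    qed
    \<comment> \<open>A position without moves lies in the kernel, because \<open>enter\<close> provides a move elsewhere.\<close>
    have "even (length h)" if "finished_play P r h" "follows_strategy \<sigma> h" for h
      using that inv[of h] enter[OF ideal, of h] unfolding finished_play_def by blast
    then show ?thesis
      using strat unfolding atniss_win_def by blast
  qed
qed


section \<open>Covers in finite posets and in rooted trees\<close>

lemma finite_partial_order_minimal:
  assumes "finite P" and po: "partial_order_on P r" and "x \<in> Q"
  obtains m where "m \<in> Q" and "\<And>y. (y, m) \<in> r \<Longrightarrow> y \<in> Q \<Longrightarrow> y = m"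
proof -
  have "finite r"
    using partial_order_onD(4)[OF po] assms(1) by (meson finite_SigmaI finite_subset)
  then have "wf (r - Id)"
    using po by (rule partial_order_on_well_order_on)
  then obtain m where "m \<in> Q" "\<And>y. (y, m) \<in> r - Id \<Longrightarrow> y \<notin> Q"
    using \<open>x \<in> Q\<close> by (rule wfE_min) auto
  then show thesis
    using that by blast
qed

lemma exists_cover_below:
  assumes "finite P" and po: "partial_order_on P r" and ab: "(a, b) \<in> r" "a \<noteq> b"
  obtains d where "covered_by r a d" and "(d, b) \<in> r"
proof -
  have b: "b \<in> {z. (a, z) \<in> r \<and> a \<noteq> z \<and> (z, b) \<in> r}"
    using ab partial_order_onD(1,4)[OF po] unfolding refl_on_def by blast
  obtain d where d: "(a, d) \<in> r" "a \<noteq> d" "(d, b) \<in> r"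
    and min: "\<And>y. (y, d) \<in> r \<Longrightarrow> (a, y) \<in> r \<and> a \<noteq> y \<and> (y, b) \<in> r \<Longrightarrow> y = d"
    using finite_partial_order_minimal[OF assms(1) po b] by auto
  have "z = a \<or> z = d" if "(a, z) \<in> r" "(z, d) \<in> r" for z
    using that min[of z] d transD[OF partial_order_onD(2)[OF po]] by blast
  then have "covered_by r a d"
    using d unfolding covered_by_def by blast
  then show thesis
    using that d by blast
qed

lemma exists_saturated_chain:
  assumes fin: "finite P" and po: "partial_order_on P r" and "(a, b) \<in> r"
  shows "\<exists>w. w \<noteq> [] \<and> hd w = a \<and> last w = b \<and> successively (covered_by r) w \<and> distinct w
           \<and> (\<forall>z\<in>set w. (a, z) \<in> r \<and> (z, b) \<in> r)"
  using \<open>(a, b) \<in> r\<close>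
proof (induction "card {z. (a, z) \<in> r}" arbitrary: a rule: less_induct)
  case less
  have refl: "(x, x) \<in> r" if "x \<in> P" for x
    using that partial_order_onD(1)[OF po] unfolding refl_on_def by blast
  have trans: "(x, z) \<in> r" if "(x, y) \<in> r" "(y, z) \<in> r" for x y z
    using that transD[OF partial_order_onD(2)[OF po]] by blast
  have antisym: "x = y" if "(x, y) \<in> r" "(y, x) \<in> r" for x y
    using that antisymD[OF partial_order_onD(3)[OF po]] by blast
  have field: "r \<subseteq> P \<times> P"
    using partial_order_onD(4)[OF po] by blast
  show ?case
  proof (cases "a = b")
    case True
    then show ?thesis
      using refl less.prems field by (intro exI[of _ "[a]"]) auto
  next
    case False
    then obtain d where d: "covered_by r a d" "(d, b) \<in> r"
      using exists_cover_below[OF fin po less.prems] by blast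
    have ad: "(a, d) \<in> r" "a \<noteq> d"
      using d(1) unfolding covered_by_def by auto
    have "finite {z. (a, z) \<in> r}"
      using fin field by (auto intro: finite_subset)
    moreover have "{z. (d, z) \<in> r} \<subset> {z. (a, z) \<in> r}"
      using ad trans antisym refl field by blast
    ultimately have "card {z. (d, z) \<in> r} < card {z. (a, z) \<in> r}"
      by (rule psubset_card_mono)
    from less.hyps[OF this d(2)] obtain w where
      w: "w \<noteq> []" "hd w = d" "last w = b" "successively (covered_by r) w" "distinct w"
        "\<And>z. z \<in> set w \<Longrightarrow> (d, z) \<in> r \<and> (z, b) \<in> r"
      by blast
    have "a \<notin> set w"
      using w(6) ad antisym by blast
    moreover have "(a, z) \<in> r" if "z \<in> set w" for z
      using w(6)[OF that] ad trans by blast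
    ultimately show ?thesis
      using w d ad less.prems field refl
      by (intro exI[of _ "a # w"]) (auto simp: successively_Cons)
  qed
qed

text \<open>
  Two saturated chains climbing from different covers \<open>x\<close>, \<open>y\<close> of \<open>c\<close> to a minimal common upper
  bound \<open>m\<close> meet only in \<open>m\<close>, so together with \<open>c\<close> they form a cycle of the Hasse diagram. A common
  upper bound exists because the unique maximal element of a finite poset is its greatest element.
\<close>

lemma unique_cover_in_rooted_tree:
  assumes fin: "finite P" and tree: "rooted_tree_poset P r"
    and cx: "covered_by r c x" and cy: "covered_by r c y"
  shows "x = y"
proof (rule ccontr)
  assume "x \<noteq> y"
  have po: "partial_order_on P r"
    and ex1: "\<exists>!x. x \<in> max_elems r P" and acyclic: "\<nexists>c. graph_cycle P (hasse_adj r) c"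
    using tree unfolding rooted_tree_poset_def graph_tree_def by auto
  have trans: "(x, z) \<in> r" if "(x, y) \<in> r" "(y, z) \<in> r" for x y z
    using that transD[OF partial_order_onD(2)[OF po]] by blast
  have antisym: "x = y" if "(x, y) \<in> r" "(y, x) \<in> r" for x y
    using that antisymD[OF partial_order_onD(3)[OF po]] by blast
  have field: "r \<subseteq> P \<times> P" and refl: "\<And>z. z \<in> P \<Longrightarrow> (z, z) \<in> r"
    using partial_order_onD(1,4)[OF po] unfolding refl_on_def by blast+
  obtain root where root: "\<And>z. z \<in> max_elems r P \<Longrightarrow> z = root"
    using ex1 by blast
  have top: "(z, root) \<in> r" if z: "z \<in> P" for z
  proof -
    have po': "partial_order_on P (r\<inverse>)"
      using po by simp
    obtain m where m: "(z, m) \<in> r" "\<And>y. (m, y) \<in> r \<Longrightarrow> (z, y) \<in> r \<Longrightarrow> y = m"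
      using finite_partial_order_minimal[OF fin po', of z "{y. (z, y) \<in> r}"] refl[OF z]
      by auto
    then have "m \<in> max_elems r P"
      using trans field unfolding max_elems_def by blast
    then show ?thesis
      using root m(1) by blast
  qed
  have c: "(c, x) \<in> r" "c \<noteq> x" "(c, y) \<in> r" "c \<noteq> y"
    using cx cy unfolding covered_by_def by auto
  have ub: "root \<in> {z. (x, z) \<in> r \<and> (y, z) \<in> r}"
    using top c field by blast
  obtain m where m_ub: "m \<in> {z. (x, z) \<in> r \<and> (y, z) \<in> r}"
    and m_min: "\<And>z. (z, m) \<in> r \<Longrightarrow> z \<in> {z. (x, z) \<in> r \<and> (y, z) \<in> r} \<Longrightarrow> z = m"
    using finite_partial_order_minimal[OF fin po ub] by blast
  have m: "(x, m) \<in> r" "(y, m) \<in> r"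
    using m_ub by auto
  have min: "z = m" if "(z, m) \<in> r" "(x, z) \<in> r" "(y, z) \<in> r" for z
    using m_min that by simp
  obtain u where u: "u \<noteq> []" "hd u = x" "last u = m" "successively (covered_by r) u" "distinct u"
    "\<And>z. z \<in> set u \<Longrightarrow> (x, z) \<in> r \<and> (z, m) \<in> r"
    using exists_saturated_chain[OF fin po m(1)] by blast
  obtain v where v: "v \<noteq> []" "hd v = y" "last v = m" "successively (covered_by r) v" "distinct v"
    "\<And>z. z \<in> set v \<Longrightarrow> (y, z) \<in> r \<and> (z, m) \<in> r"
    using exists_saturated_chain[OF fin po m(2)] by blast
  define v' where "v' = butlast v"
  have v_eq: "v = v' @ [m]"
    using v(1,3) unfolding v'_def by (metis append_butlast_last_id)
  have c_notin: "c \<notin> set u" "c \<notin> set v"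
    using u(6) v(6) c antisym by blast+
  \<comment> \<open>Up from \<open>c\<close> through \<open>x\<close> to \<open>m\<close>, then down towards \<open>y\<close>; the last vertex is \<open>y\<close> also when
    \<open>y = m\<close> and the descending part is empty.\<close>
  let ?cyc = "(c # u) @ rev v'"
  have last: "last ?cyc = y"
    using u(1,3) v(2) by (cases v') (auto simp: v_eq)
  have "z \<notin> set v'" if "z \<in> set u" for z
    using that u(6) v(5,6) min[of z] by (auto simp: v_eq)
  then have "distinct ?cyc"
    using u(5) v(5) c_notin by (auto simp: v_eq)
  moreover have "3 \<le> length ?cyc"
  proof -
    have "{c, x, y} \<subseteq> set ?cyc"
      using hd_in_set[OF u(1)] last_in_set[of ?cyc] unfolding last u(2) by simp
    moreover have "card {c, x, y} = 3"
      using c \<open>x \<noteq> y\<close> by simp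
    ultimately show ?thesis
      using card_mono[of "set ?cyc" "{c, x, y}"] card_length[of ?cyc] by simp
  qed
  moreover have "set ?cyc \<subseteq> P"
    using c(1) field u(6) v(6) by (auto simp: v_eq)
  moreover have "successively (hasse_adj r) ?cyc"
  proof -
    have "successively (hasse_adj r) u"
      using u(4) by (rule successively_mono) (auto simp: hasse_adj_def)
    moreover have "successively (hasse_adj r) (rev v)"
      using v(4) unfolding successively_rev
      by (rule successively_mono) (auto simp: hasse_adj_def)
    moreover have "hasse_adj r c x"
      using cx by (simp add: hasse_adj_def)
    ultimately show ?thesis
      using u(1-3) by (auto simp: v_eq successively_append_iff successively_Cons)
  qed
  moreover have "hasse_adj r (last ?cyc) (hd ?cyc)"
    unfolding last using cy by (simp add: hasse_adj_def)
  ultimately show False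
    using acyclic unfolding graph_cycle_def by blast
qed


section \<open>The kernel of the game on a rooted tree\<close>

text \<open>
  Minimal elements obey the NAND recursion too, since NAND of the empty family is \<open>0\<close>.
\<close>

lemma nand_value_iff:
  assumes "finite P" and po: "partial_order_on P r"
  shows "nand_value P r x \<longleftrightarrow> (\<exists>y. covered_by r y x \<and> \<not> nand_value P r y)"
proof (cases "x \<in> min_elems r P")
  case True
  then have "\<not> covered_by r y x" for y
    using partial_order_onD(4)[OF po] unfolding min_elems_def covered_by_def by blast
  then show ?thesis
    using nand_value_minimal[OF assms True] by blast
next
  case False
  then show ?thesis
    using nand_value_nonminimal[OF assms False] by (simp add: nand_def)
qed

text \<open>
  A deleted root of value \<open>1\<close> has a child of value \<open>0\<close>. That root is the child's only cover, so the
  child is maximal once the root is gone.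
\<close>

lemma move_from_lost_position:
  assumes fin: "finite P" and tree: "rooted_tree_poset P r" and X: "order_ideal P r X"
    and lost: "\<forall>x\<in>max_elems r X. nand_value P r x" and move: "ungar_move r X Y"
  shows "\<not> (\<forall>y\<in>max_elems r Y. nand_value P r y)"
proof -
  have po: "partial_order_on P r"
    using tree unfolding rooted_tree_poset_def by simp
  obtain T where T: "T \<noteq> {}" "T \<subseteq> max_elems r X" "Y = X - T"
    using move unfolding ungar_move_def by blast
  then obtain x where x: "x \<in> T" "x \<in> max_elems r X"
    by blast
  then obtain c where c: "covered_by r c x" "\<not> nand_value P r c"
    using lost nand_value_iff[OF fin po] by blast
  have cx: "(c, x) \<in> r" "c \<noteq> x"
    using c(1) unfolding covered_by_def by auto
  then have "c \<in> X" "c \<notin> max_elems r X"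
    using X x(2) unfolding order_ideal_def max_elems_def by blast+
  then have "c \<in> Y"
    using T by blast
  moreover have "z = c" if z: "z \<in> Y" "(c, z) \<in> r" for z
  proof (rule ccontr)
    assume "z \<noteq> c"
    then obtain d where d: "covered_by r c d" "(d, z) \<in> r"
      using exists_cover_below[OF fin po z(2)] by blast
    then have "(x, z) \<in> r"
      using unique_cover_in_rooted_tree[OF fin tree c(1) d(1)] by simp
    then show False
      using z(1) T(3) x unfolding max_elems_def by blast
  qed
  ultimately show ?thesis
    using c(2) unfolding max_elems_def by blast
qed

text \<open>
  Deleting all roots of value \<open>0\<close> works: a newly exposed element is covered by a deleted root, and
  all children of an element of value \<open>0\<close> have value \<open>1\<close>.
\<close>

lemma move_to_lost_position:
  assumes fin: "finite P" and po: "partial_order_on P r" and X: "order_ideal P r X"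
    and not_lost: "\<not> (\<forall>x\<in>max_elems r X. nand_value P r x)"
  shows "\<exists>Y. ungar_move r X Y \<and> (\<forall>y\<in>max_elems r Y. nand_value P r y)"
proof -
  let ?T = "{x \<in> max_elems r X. \<not> nand_value P r x}"
  have "ungar_move r X (X - ?T)"
    unfolding ungar_move_def using not_lost by (intro exI[of _ ?T]) auto
  moreover have "nand_value P r y" if y: "y \<in> max_elems r (X - ?T)" for y
  proof (cases "y \<in> max_elems r X")
    case True
    then show ?thesis
      using y unfolding max_elems_def by blast
  next
    case False
    then obtain w where w: "w \<in> X" "(y, w) \<in> r" "y \<noteq> w"
      using y unfolding max_elems_def by blast
    then obtain z where z: "covered_by r y z" "(z, w) \<in> r"
      using exists_cover_below[OF fin po] by blast
    then have "z \<in> X"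
      using X w(1) unfolding order_ideal_def by blast
    moreover have "z \<notin> X - ?T"
      using y z(1) unfolding max_elems_def covered_by_def by blast
    ultimately have "\<not> nand_value P r z"
      by blast
    then show ?thesis
      using nand_value_iff[OF fin po, of z] z(1) by blast
  qed
  ultimately show ?thesis
    by blast
qed

theorem theorem1p7:
  fixes P :: "'a set" and r :: "'a rel"
  assumes "finite P" and "rooted_tree_poset P r"
  shows "(nand_output P r = True \<longrightarrow> eeta_win P r) \<and> (nand_output P r = False \<longrightarrow> atniss_win P r)"
proof -
  have po: "partial_order_on P r" and root: "\<exists>!x. x \<in> max_elems r P"
    using assms(2) unfolding rooted_tree_poset_def by auto
  have "atniss_win P r \<longleftrightarrow> \<not> (\<forall>x\<in>max_elems r P. nand_value P r x)"
    using atniss_win_iff_not_in_kernel[OF assms(1) po,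
        where L = "\<lambda>X. \<forall>x\<in>max_elems r X. nand_value P r x"]
      move_from_lost_position[OF assms] move_to_lost_position[OF assms(1) po]
    by blast
  also have "(\<forall>x\<in>max_elems r P. nand_value P r x) \<longleftrightarrow> nand_output P r"
    unfolding nand_output_def using root theI'[OF root] by blast
  finally show ?thesis
    unfolding eeta_win_def by simp
qed

end
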